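(* Let $(\mathcal{A},\varepsilon)$ be a signed support in $\mathbb{R}^n$. If for all (nonempty) faces $F\subseteq\operatorname{Conv}(\mathcal{A})$, including $F=\operatorname{Conv}(\mathcal{A})$, the signed support $(\mathcal{A}_F,\varepsilon_F)$ has a non-trivial separating hyperplane, then for all $c\in\mathbb{R}^{\mathcal{A}}_\varepsilon$ the hypersurfaces $Z(f_c)\subseteq\mathbb{R}^n$ have the same isotopy type.
   Context: A signed support $(\mathcal{A},\varepsilon)$ in $\mathbb{R}^n$ consists of a finite set $\mathcal{A}=\{\alpha_1,\dots,\alpha_{n+k+1}\}\subseteq\mathbb{R}^n$ of (distinct) exponent vectors and a sign distribution $\varepsilon\in\{\pm1\}^{n+k+1}$. Put $\mathcal{A}_+=\{\alpha_i:\varepsilon_i=1\}$, $\mathcal{A}_-=\{\alpha_i:\varepsilon_i=-1\}$ and $\mathbb{R}^{\mathcal{A}}_\varepsilon=\{c\in\mathbb{R}^{n+k+1}:\operatorname{sign}(c)=\varepsilon\}$. For $c\in\mathbb{R}^{\mathcal{A}}_\varepsilon$ let $f_c(x)=\sum_i c_i e^{\alpha_i\cdot x}$ on $\mathbb{R}^n$ and $Z(f_c)=\{x\in\mathbb{R}^n:f_c(x)=0\}$. For a face $F$ of the polytope $\operatorname{Conv}(\mathcal{A})$, $\mathcal{A}_F=\mathcal{A}\cap F$ and $\varepsilon_F=(\varepsilon_i)_{\alpha_i\in\mathcal{A}_F}$; this is again regarded as a signed support in $\mathbb{R}^n$. For $v\in\mathbb{R}^n\setminus\{0\}$, $a\in\mathbb{R}$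 let $\mathcal{H}_{v,a}=\{\mu:v\cdot\mu=a\}$, $\mathcal{H}^+_{v,a}=\{\mu:v\cdot\mu\ge a\}$, $\mathcal{H}^-_{v,a}=\{\mu:v\cdot\mu\le a\}$. $\mathcal{H}_{v,a}$ is a separating hyperplane of a signed support if its positive exponent vectors lie in $\mathcal{H}^+_{v,a}$ and its negative exponent vectors lie in $\mathcal{H}^-_{v,a}$; it is non-trivial if at least one of the open half-spaces $\operatorname{int}(\mathcal{H}^+_{v,a})$, $\operatorname{int}(\mathcal{H}^-_{v,a})$ contains a point of the support. Two subsets $Z_0,Z_1\subseteq\mathbb{R}^n$ are isotopic (have the same isotopy type) if there is a continuous map $H:[0,1]\times\mathbb{R}^n\to\mathbb{R}^n$ such that $H(t,\cdot)$ is a homeomorphism for all $t\in[0,1]$, $H(0,\cdot)$ is the identity, and $H(1,Z_0)=Z_1$. *)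

theory Defs
  imports "HOL-Analysis.Analysis"
begin

text \<open>
  Sign distributions and coefficient vectors are indexed by the exponent vectors themselves:
  they are functions on the ambient space of which only the values on the support matter.
  In particular, the restriction of a signed support \<open>(A, \<epsilon>)\<close> to a face \<open>F\<close> is \<open>(A \<inter> F, \<epsilon>)\<close>.
\<close>

definition signed_support :: "(real ^ 'n) set \<Rightarrow> (real ^ 'n \<Rightarrow> real) \<Rightarrow> bool" where
  "signed_support A \<epsilon> \<longleftrightarrow> finite A \<and> (\<forall>\<alpha>\<in>A. \<epsilon> \<alpha> \<in> {1, -1})"

definition pos_part :: "(real ^ 'n) set \<Rightarrow> (real ^ 'n \<Rightarrow> real) \<Rightarrow> (real ^ 'n) set" where
  "pos_part A \<epsilon> = {\<alpha> \<in> A. \<epsilon> \<alpha> = 1}"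

definition neg_part :: "(real ^ 'n) set \<Rightarrow> (real ^ 'n \<Rightarrow> real) \<Rightarrow> (real ^ 'n) set" where
  "neg_part A \<epsilon> = {\<alpha> \<in> A. \<epsilon> \<alpha> = -1}"

definition sign_orthant :: "(real ^ 'n) set \<Rightarrow> (real ^ 'n \<Rightarrow> real) \<Rightarrow> (real ^ 'n \<Rightarrow> real) set" where
  "sign_orthant A \<epsilon> = {c. \<forall>\<alpha>\<in>A. sgn (c \<alpha>) = \<epsilon> \<alpha>}"

definition exp_sum :: "(real ^ 'n) set \<Rightarrow> (real ^ 'n \<Rightarrow> real) \<Rightarrow> real ^ 'n \<Rightarrow> real" where
  "exp_sum A c x = (\<Sum>\<alpha>\<in>A. c \<alpha> * exp (\<alpha> \<bullet> x))"

definition zero_set :: "(real ^ 'n \<Rightarrow> real) \<Rightarrow> (real ^ 'n) set" where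
  "zero_set f = {x. f x = 0}"

definition halfspace_ge :: "real ^ 'n \<Rightarrow> real \<Rightarrow> (real ^ 'n) set" where
  "halfspace_ge v a = {\<mu>. v \<bullet> \<mu> \<ge> a}"

definition halfspace_le :: "real ^ 'n \<Rightarrow> real \<Rightarrow> (real ^ 'n) set" where
  "halfspace_le v a = {\<mu>. v \<bullet> \<mu> \<le> a}"

text \<open>
  The hyperplane \<open>{\<mu>. v \<bullet> \<mu> = a}\<close> is represented by the pair \<open>(v, a)\<close>, since the
  two sides of it are told apart by the orientation of \<open>v\<close>.
\<close>

definition separating_hyperplane ::
    "(real ^ 'n) set \<Rightarrow> (real ^ 'n \<Rightarrow> real) \<Rightarrow> real ^ 'n \<Rightarrow> real \<Rightarrow> bool" where
  "separating_hyperplane A \<epsilon> v a \<longleftrightarrow>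
     v \<noteq> 0 \<and> pos_part A \<epsilon> \<subseteq> halfspace_ge v a \<and> neg_part A \<epsilon> \<subseteq> halfspace_le v a"

definition nontrivial_separating_hyperplane ::
    "(real ^ 'n) set \<Rightarrow> (real ^ 'n \<Rightarrow> real) \<Rightarrow> real ^ 'n \<Rightarrow> real \<Rightarrow> bool" where
  "nontrivial_separating_hyperplane A \<epsilon> v a \<longleftrightarrow>
     separating_hyperplane A \<epsilon> v a \<and>
     (A \<inter> interior (halfspace_ge v a) \<noteq> {} \<or> A \<inter> interior (halfspace_le v a) \<noteq> {})"

text \<open>
  The isotopy is ambient: each \<open>H (t, \<cdot>)\<close> is a homeomorphism of the whole space onto itself.
\<close>

definition isotopic :: "(real ^ 'n) set \<Rightarrow> (real ^ 'n) set \<Rightarrow> bool" where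
  "isotopic Z0 Z1 \<longleftrightarrow>
     (\<exists>H :: real \<times> (real ^ 'n) \<Rightarrow> real ^ 'n.
        continuous_on ({0..1} \<times> UNIV) H \<and>
        (\<forall>t\<in>{0..1}. \<exists>G. homeomorphism UNIV UNIV (\<lambda>x. H (t, x)) G) \<and>
        (\<forall>x. H (0, x) = x) \<and>
        (\<lambda>x. H (1, x)) ` Z0 = Z1)"

end

theory Submission
  imports Defs
begin

text \<open>
  Let \<open>(v, a)\<close> be a non-trivial separating hyperplane of the whole support.  Along every line in
  direction \<open>v\<close> the function \<open>s \<mapsto> exp (- a * s) * f (x + s * v)\<close> is strictly increasing, because
  each of its terms is non-decreasing and one is not constant.  So the problem is essentially one
  about increasing functions of one real variable, and no vector fields have to be integrated.

  Fix a path \<open>\<gamma>\<close> of coefficient vectors in the sign orthant and write \<open>f\<^sub>t\<close> for the exponential sum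
  with coefficients \<open>\<gamma> t\<close>.  Rather than just moving zeros to zeros, the proof constructs bijections
  \<open>\<Phi>\<^sub>t\<close> of the space and positive factors \<open>\<rho>\<^sub>t\<close> with \<open>f\<^sub>t (\<Phi>\<^sub>t x) = \<rho>\<^sub>t x * f\<^sub>0 x\<close>.  The proportionality
  makes an induction over faces possible.  If the support has points strictly on one side of the
  hyperplane only, the remaining points span a proper face (possibly an empty one); let \<open>B\<close> be the
  points on it and \<open>C\<close> the others.  By induction there are \<open>\<Phi>\<close> and \<open>\<rho>\<close> for \<open>B\<close>, and
  \<open>\<Phi>\<^sub>t x + \<tau> * v\<close> is tried for the whole support.  All points of \<open>B\<close> have inner product \<open>a\<close>
  with \<open>v\<close>, so the shift by \<open>\<tau> * v\<close> multiplies the \<open>B\<close>-part by \<open>exp (a * \<tau>)\<close>; thus \<open>\<tau>\<close> only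
  has to be chosen such that the \<open>C\<close>-part is multiplied by \<open>exp (a * \<tau>) * \<rho>\<^sub>t x\<close> as well.  After
  division by \<open>exp (a * \<tau>)\<close> the terms of the \<open>C\<close>-part all have the same sign and are strictly
  increasing in \<open>\<tau>\<close>, with one end at 0 and the other at infinity, so there is exactly one solution, which
  depends continuously on \<open>t\<close> and \<open>x\<close>.  If the support has points strictly on both sides, the same
  argument applies with \<open>B\<close> empty, since then the increasing function is onto the reals.

  For the new map to be bijective, \<open>\<Phi>\<^sub>t\<close> has to send lines in direction \<open>v\<close> to lines in
  direction \<open>v\<close>.  The induction therefore also provides that \<open>\<Phi>\<^sub>t\<close> commutes with, and \<open>\<rho>\<^sub>t\<close> is invariant
  under, all translations by vectors whose inner product with the support is constant.  The
  inductive step is \<open>proportional_isotopy_extend\<close>, the induction is \<open>ex_proportional_isotopy\<close>.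
\<close>

section \<open>Monotone exponential sums in one variable\<close>

lemma exp_sum_line_strict_mono:
  fixes k m :: "'a \<Rightarrow> real"
  assumes "finite C" "\<And>i. i \<in> C \<Longrightarrow> k i * m i \<ge> 0" "j \<in> C" "k j * m j > 0"
  shows "strict_mono (\<lambda>s. \<Sum>i\<in>C. k i * exp (m i * s))"
proof (rule strict_monoI)
  fix s r :: real
  assume sr: "s < r"
  have le: "k i * exp (m i * s) \<le> k i * exp (m i * r)" if "k i * m i \<ge> 0" for i
  proof (cases "k i > 0")
    case True
    with that have "m i \<ge> 0" by (simp add: zero_le_mult_iff)
    with True sr show ?thesis by (auto intro!: mult_left_mono)
  next
    case False
    with that have "k i = 0 \<or> (k i < 0 \<and> m i \<le> 0)" by (auto simp: zero_le_mult_iff)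
    moreover have "m i \<le> 0 \<Longrightarrow> m i * r \<le> m i * s" using sr by (intro mult_left_mono_neg) auto
    ultimately show ?thesis by (auto intro: mult_left_mono_neg)
  qed
  have "k j * exp (m j * s) \<noteq> k j * exp (m j * r)" using assms(4) sr by auto
  with le[of j] assms(4) have "k j * exp (m j * s) < k j * exp (m j * r)" by linarith
  then show "(\<Sum>i\<in>C. k i * exp (m i * s)) < (\<Sum>i\<in>C. k i * exp (m i * r))"
    using assms(1,2,3) le by (intro sum_strict_mono_ex1) auto
qed

lemma exp_sum_line_at_top:
  fixes k m :: "'a \<Rightarrow> real"
  assumes "finite C" "\<And>i. i \<in> C \<Longrightarrow> k i * m i \<ge> 0" "j \<in> C" "k j > 0" "m j > 0"
  shows "filterlim (\<lambda>s. \<Sum>i\<in>C. k i * exp (m i * s)) at_top at_top"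
proof (rule filterlim_at_top_mono)
  let ?r = "\<Sum>i\<in>C - {j}. k i"
  have "filterlim (\<lambda>s. m j * s) at_top at_top"
    using assms(5) by (intro filterlim_tendsto_pos_mult_at_top[OF tendsto_const _ filterlim_ident])
  then have "filterlim (\<lambda>s. exp (m j * s)) at_top at_top"
    by (rule filterlim_compose[OF exp_at_top])
  then have "filterlim (\<lambda>s. k j * exp (m j * s)) at_top at_top"
    using assms(4) by (intro filterlim_tendsto_pos_mult_at_top[OF tendsto_const])
  then show "filterlim (\<lambda>s. ?r + k j * exp (m j * s)) at_top at_top"
    by (rule filterlim_tendsto_add_at_top[OF tendsto_const])
  have "?r + k j * exp (m j * s) \<le> (\<Sum>i\<in>C. k i * exp (m i * s))" if "s \<ge> 0" for s
  proof -
    have "k i \<le> k i * exp (m i * s)" if "i \<in> C" for i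
    proof (cases "k i > 0")
      case True
      with assms(2)[OF that] have "m i \<ge> 0" by (simp add: zero_le_mult_iff)
      with True \<open>s \<ge> 0\<close> show ?thesis by simp
    next
      case False
      with assms(2)[OF that] have "k i = 0 \<or> (k i < 0 \<and> m i \<le> 0)"
        by (auto simp: zero_le_mult_iff)
      moreover have "m i \<le> 0 \<Longrightarrow> exp (m i * s) \<le> 1"
        using \<open>s \<ge> 0\<close> by (simp add: mult_nonpos_nonneg)
      ultimately show ?thesis using mult_left_mono_neg[of "exp (m i * s)" 1 "k i"] by auto
    qed
    then have "?r \<le> (\<Sum>i\<in>C - {j}. k i * exp (m i * s))" by (intro sum_mono) auto
    then show ?thesis using assms(1,3) by (simp add: sum.remove)
  qed
  then show "\<forall>\<^sub>F s in at_top. ?r + k j * exp (m j * s) \<le> (\<Sum>i\<in>C. k i * exp (m i * s))"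
    by (auto simp: eventually_at_top_linorder)
qed

text \<open>
  Changing the signs of all coefficients and exponents preserves \<open>k i * m i \<ge> 0\<close> and swaps the two
  sides of the hyperplane, so the behaviour at one end determines that at the other.
\<close>

lemma exp_sum_line_reflect:
  fixes k m :: "'a \<Rightarrow> real"
  shows "(\<Sum>i\<in>C. k i * exp (m i * s)) = - (\<Sum>i\<in>C. - k i * exp (- m i * (- s)))"
  by (simp add: sum_negf)

lemma exp_sum_line_at_bot:
  fixes k m :: "'a \<Rightarrow> real"
  assumes "finite C" "\<And>i. i \<in> C \<Longrightarrow> k i * m i \<ge> 0" "j \<in> C" "k j < 0" "m j < 0"
  shows "filterlim (\<lambda>s. \<Sum>i\<in>C. k i * exp (m i * s)) at_bot at_bot"
proof -
  have "filterlim (\<lambda>s. \<Sum>i\<in>C. - k i * exp (- m i * s)) at_top at_top"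
    using assms by (intro exp_sum_line_at_top[where j = j]) auto
  then have "filterlim (\<lambda>s. \<Sum>i\<in>C. - k i * exp (- m i * (- s))) at_top at_bot"
    by (rule filterlim_compose[OF _ filterlim_uminus_at_top_at_bot])
  then show ?thesis
    by (subst exp_sum_line_reflect) (simp add: filterlim_uminus_at_top)
qed

lemma continuous_crosses_value:
  fixes g :: "real \<Rightarrow> real"
  assumes "continuous_on UNIV g" "\<forall>\<^sub>F s in at_bot. g s \<le> w" "\<forall>\<^sub>F s in at_top. w \<le> g s"
  shows "w \<in> range g"
proof -
  obtain p where p: "\<And>s. s \<le> p \<Longrightarrow> g s \<le> w"
    using assms(2) by (auto simp: eventually_at_bot_linorder)
  obtain q where q: "\<And>s. s \<ge> q \<Longrightarrow> w \<le> g s"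
    using assms(3) by (auto simp: eventually_at_top_linorder)
  have "\<exists>s. min p q \<le> s \<and> s \<le> max p q \<and> g s = w"
    by (rule IVT') (use p q assms(1) in \<open>auto intro: continuous_on_subset\<close>)
  then show ?thesis by blast
qed

lemma range_exp_sum_line_two_sided:
  fixes k m :: "'a \<Rightarrow> real"
  assumes "finite C" "\<And>i. i \<in> C \<Longrightarrow> k i * m i \<ge> 0"
    and "i \<in> C" "k i > 0" "m i > 0" "j \<in> C" "k j < 0" "m j < 0"
  shows "range (\<lambda>s. \<Sum>i\<in>C. k i * exp (m i * s)) = UNIV"
proof -
  have "w \<in> range (\<lambda>s. \<Sum>i\<in>C. k i * exp (m i * s))" for w
  proof (rule continuous_crosses_value)
    show "\<forall>\<^sub>F s in at_bot. (\<Sum>i\<in>C. k i * exp (m i * s)) \<le> w"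
      using exp_sum_line_at_bot[of C k m j] assms by (simp add: filterlim_at_bot)
    show "\<forall>\<^sub>F s in at_top. w \<le> (\<Sum>i\<in>C. k i * exp (m i * s))"
      using exp_sum_line_at_top[of C k m i] assms by (simp add: filterlim_at_top)
  qed (intro continuous_intros)
  then show ?thesis by blast
qed

lemma range_exp_sum_line_pos:
  fixes k m :: "'a \<Rightarrow> real"
  assumes "finite C" "C \<noteq> {}" "\<And>i. i \<in> C \<Longrightarrow> k i > 0 \<and> m i > 0"
  shows "range (\<lambda>s. \<Sum>i\<in>C. k i * exp (m i * s)) = {0<..}" (is "range ?g = _")
proof -
  obtain j where j: "j \<in> C" using assms(2) by blast
  have pos: "?g s > 0" for s using assms by (intro sum_pos) auto
  have "w \<in> range ?g" if "w > 0" for w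
  proof (rule continuous_crosses_value)
    have "((\<lambda>s. exp (m i * s)) \<longlongrightarrow> 0) at_bot" if "i \<in> C" for i
    proof (rule filterlim_compose[OF exp_at_bot])
      show "filterlim (\<lambda>s. m i * s) at_bot at_bot"
        using assms(3)[OF that]
        by (intro filterlim_tendsto_pos_mult_at_bot[OF tendsto_const _ filterlim_ident]) auto
    qed
    then have "(?g \<longlongrightarrow> (\<Sum>i\<in>C. k i * 0)) at_bot" by (intro tendsto_intros)
    then have "\<forall>\<^sub>F s in at_bot. ?g s < w" using \<open>w > 0\<close> by (intro order_tendstoD(2)) auto
    then show "\<forall>\<^sub>F s in at_bot. ?g s \<le> w" by (rule eventually_mono) simp
    have "filterlim ?g at_top at_top"
      using assms j by (intro exp_sum_line_at_top[where j = j]) (auto simp: less_imp_le)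
    then show "\<forall>\<^sub>F s in at_top. w \<le> ?g s" by (simp add: filterlim_at_top)
  qed (intro continuous_intros)
  then have "{0<..} \<subseteq> range ?g" by auto
  moreover have "range ?g \<subseteq> {0<..}" using pos by auto
  ultimately show ?thesis by (rule equalityI[rotated])
qed

lemma range_exp_sum_line_neg:
  fixes k m :: "'a \<Rightarrow> real"
  assumes "finite C" "C \<noteq> {}" "\<And>i. i \<in> C \<Longrightarrow> k i < 0 \<and> m i < 0"
  shows "range (\<lambda>s. \<Sum>i\<in>C. k i * exp (m i * s)) = {..<0}"
proof -
  let ?h = "\<lambda>s. \<Sum>i\<in>C. - k i * exp (- m i * s)"
  have h: "range ?h = {0<..}"
    using assms by (intro range_exp_sum_line_pos) auto
  have "(\<lambda>s. \<Sum>i\<in>C. k i * exp (m i * s)) = uminus \<circ> ?h \<circ> uminus"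
    by (auto simp: sum_negf)
  then have "range (\<lambda>s. \<Sum>i\<in>C. k i * exp (m i * s)) = uminus ` range (?h \<circ> uminus)"
    by (simp only: comp_assoc image_comp)
  also have "range (?h \<circ> uminus) = range ?h"
    by (simp only: image_comp[symmetric] surj_uminus)
  also note h
  finally show ?thesis by simp
qed

text \<open>
  Strict monotonicity replaces the implicit function theorem: \<open>p < \<sigma> x\<close> is equivalent to
  \<open>G x p < 0\<close>, which is an open condition on \<open>x\<close>.
\<close>

lemma continuous_on_zero_of_strict_mono:
  fixes G :: "'a::topological_space \<Rightarrow> real \<Rightarrow> real"
  assumes mono: "\<And>x. x \<in> S \<Longrightarrow> strict_mono (G x)"
    and cont: "\<And>s. continuous_on S (\<lambda>x. G x s)"
    and zero: "\<And>x. x \<in> S \<Longrightarrow> G x (\<sigma> x) = 0"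
  shows "continuous_on S \<sigma>"
  unfolding continuous_on_def
proof (intro ballI order_tendstoI)
  fix x p
  assume x: "x \<in> S"
  have lim: "((\<lambda>y. G y p) \<longlongrightarrow> G x p) (at x within S)"
    using cont x by (auto simp: continuous_on_def)
  have S: "\<forall>\<^sub>F y in at x within S. y \<in> S" by (simp add: eventually_at_filter)
  have less: "G y p < 0 \<longleftrightarrow> p < \<sigma> y" "0 < G y p \<longleftrightarrow> \<sigma> y < p" if "y \<in> S" for y
    using strict_mono_less[OF mono[OF that], of p "\<sigma> y"]
      strict_mono_less[OF mono[OF that], of "\<sigma> y" p] zero[OF that] by simp_all
  show "\<forall>\<^sub>F y in at x within S. p < \<sigma> y" if "p < \<sigma> x"
  proof -
    have "\<forall>\<^sub>F y in at x within S. G y p < 0"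
      using that less(1)[OF x] by (intro order_tendstoD(2)[OF lim]) simp
    with S show ?thesis by eventually_elim (simp add: less)
  qed
  show "\<forall>\<^sub>F y in at x within S. \<sigma> y < p" if "\<sigma> x < p"
  proof -
    have "\<forall>\<^sub>F y in at x within S. 0 < G y p"
      using that less(2)[OF x] by (intro order_tendstoD(1)[OF lim]) simp
    with S show ?thesis by eventually_elim (simp add: less)
  qed
qed

section \<open>Exponential sums under translations\<close>

text \<open>
  The factor \<open>exp (- a * s)\<close> moves the hyperplane to level 0: the points of the support on it
  contribute constants, and the others grow or decay in \<open>s\<close> according to the side on which they lie.
\<close>

lemma exp_sum_line:
  "exp (- a * s) * exp_sum C c (x + s *\<^sub>R v) =
     (\<Sum>\<alpha>\<in>C. (c \<alpha> * exp (\<alpha> \<bullet> x)) * exp ((v \<bullet> \<alpha> - a) * s))"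
  unfolding exp_sum_def sum_distrib_left
proof (rule sum.cong[OF refl])
  fix \<alpha>
  have "exp (- a * s) * exp (\<alpha> \<bullet> (x + s *\<^sub>R v)) = exp (\<alpha> \<bullet> x) * exp ((v \<bullet> \<alpha> - a) * s)"
    unfolding exp_add[symmetric] by (simp add: inner_add_right inner_commute algebra_simps)
  then show "exp (- a * s) * (c \<alpha> * exp (\<alpha> \<bullet> (x + s *\<^sub>R v))) =
      c \<alpha> * exp (\<alpha> \<bullet> x) * exp ((v \<bullet> \<alpha> - a) * s)"
    by (simp add: mult_ac)
qed

lemma exp_sum_translate:
  assumes "\<And>\<alpha>. \<alpha> \<in> C \<Longrightarrow> \<alpha> \<bullet> u = b"
  shows "exp_sum C c (x + u) = exp b * exp_sum C c x"
  unfolding exp_sum_def sum_distrib_left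
  by (rule sum.cong[OF refl]) (simp add: assms inner_add_right exp_add mult_ac)

lemma exp_sum_split:
  assumes "finite A" "B \<subseteq> A"
  shows "exp_sum A c x = exp_sum B c x + exp_sum (A - B) c x"
  unfolding exp_sum_def by (simp add: sum.subset_diff[OF assms(2,1)])

lemma continuous_on_exp_sum:
  assumes "\<And>\<alpha>. \<alpha> \<in> C \<Longrightarrow> continuous_on S (\<lambda>z. c z \<alpha>)" "continuous_on S g"
  shows "continuous_on S (\<lambda>z. exp_sum C (c z) (g z))"
  unfolding exp_sum_def using assms by (intro continuous_intros)

section \<open>Isotopies that multiply the exponential sum by a positive factor\<close>

definition sign_path ::
    "(real ^ 'n) set \<Rightarrow> (real ^ 'n \<Rightarrow> real) \<Rightarrow> (real \<Rightarrow> real ^ 'n \<Rightarrow> real) \<Rightarrow> bool" where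
  "sign_path A \<epsilon> \<gamma> \<longleftrightarrow>
     (\<forall>t\<in>{0..1}. \<gamma> t \<in> sign_orthant A \<epsilon>) \<and> (\<forall>\<alpha>\<in>A. continuous_on {0..1} (\<lambda>t. \<gamma> t \<alpha>))"

text \<open>
  The last clause is the equivariance that makes the maps preserve the lines along which the
  next inductive step moves points: the normal vector of a hyperplane has constant inner product
  with the part of the support that lies on it.
\<close>

definition proportional_isotopy ::
    "(real ^ 'n) set \<Rightarrow> (real \<Rightarrow> real ^ 'n \<Rightarrow> real) \<Rightarrow> (real \<times> (real ^ 'n) \<Rightarrow> real ^ 'n) \<Rightarrow>
     (real \<times> (real ^ 'n) \<Rightarrow> real) \<Rightarrow> bool" where
  "proportional_isotopy A \<gamma> \<Phi> \<rho> \<longleftrightarrow>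
     continuous_on ({0..1} \<times> UNIV) \<Phi> \<and> continuous_on ({0..1} \<times> UNIV) \<rho> \<and>
     (\<forall>t\<in>{0..1}. bij (\<lambda>x. \<Phi> (t, x))) \<and>
     (\<forall>x. \<Phi> (0, x) = x \<and> \<rho> (0, x) = 1) \<and>
     (\<forall>t\<in>{0..1}. \<forall>x. \<rho> (t, x) > 0 \<and> exp_sum A (\<gamma> t) (\<Phi> (t, x)) = \<rho> (t, x) * exp_sum A (\<gamma> 0) x) \<and>
     (\<forall>u b. (\<forall>\<alpha>\<in>A. \<alpha> \<bullet> u = b) \<longrightarrow>
        (\<forall>t\<in>{0..1}. \<forall>x. \<Phi> (t, x + u) = \<Phi> (t, x) + u \<and> \<rho> (t, x + u) = \<rho> (t, x)))"

lemma proportional_isotopy_empty: "proportional_isotopy {} \<gamma> snd (\<lambda>_. 1)"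
  by (auto simp: proportional_isotopy_def exp_sum_def bij_def intro!: continuous_intros)

text \<open>
  The inductive step.  The set \<open>R\<close> is the common range of all the increasing functions along lines
  in direction \<open>v\<close>; it is closed under positive scaling (the reals or an open half-line), so the
  equation that determines the displacement \<open>\<tau>\<close> along \<open>v\<close> is always solvable.  To invert the new map
  at \<open>z = \<Phi>\<^sub>t y\<close>, equivariance allows looking for the preimage on the line \<open>y + s * v\<close>, where the same
  equation reads \<open>\<rho>\<^sub>t y * exp (- a * s) * g\<^sub>0 (y + s * v) = g\<^sub>t z\<close>, where \<open>g\<^sub>t\<close> is the exponential
  sum over \<open>A - B\<close> with coefficients \<open>\<gamma> t\<close>, and is again monotone in \<open>s\<close>.
\<close>

lemma proportional_isotopy_extend:
  fixes A B :: "(real ^ 'n) set" and v :: "real ^ 'n" and a :: real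
    and \<gamma> :: "real \<Rightarrow> real ^ 'n \<Rightarrow> real"
  defines "D \<equiv> \<lambda>t x s. exp (- a * s) * exp_sum (A - B) (\<gamma> t) (x + s *\<^sub>R v)"
  assumes fin: "finite A" and BA: "B \<subseteq> A" and B: "\<And>\<alpha>. \<alpha> \<in> B \<Longrightarrow> v \<bullet> \<alpha> = a"
    and \<gamma>: "\<And>\<alpha>. \<alpha> \<in> A \<Longrightarrow> continuous_on {0..1} (\<lambda>t. \<gamma> t \<alpha>)"
    and mono: "\<And>t x. t \<in> {0..1} \<Longrightarrow> strict_mono (D t x)"
    and range: "\<And>t x. t \<in> {0..1} \<Longrightarrow> range (D t x) = R"
    and scale: "\<And>r w. r > 0 \<Longrightarrow> w \<in> R \<Longrightarrow> r * w \<in> R"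
    and iso: "proportional_isotopy B \<gamma> \<Phi> \<rho>"
  shows "\<exists>\<Phi>' \<rho>'. proportional_isotopy A \<gamma> \<Phi>' \<rho>'"
proof -
  let ?f = "\<lambda>t. exp_sum (A - B) (\<gamma> t)"
  have cont\<Phi>: "continuous_on ({0..1} \<times> UNIV) \<Phi>" and cont\<rho>: "continuous_on ({0..1} \<times> UNIV) \<rho>"
    and bij: "\<And>t. t \<in> {0..1} \<Longrightarrow> bij (\<lambda>x. \<Phi> (t, x))"
    and start: "\<And>x. \<Phi> (0, x) = x" "\<And>x. \<rho> (0, x) = 1"
    and pos: "\<And>t x. t \<in> {0..1} \<Longrightarrow> \<rho> (t, x) > 0"
    and scaled: "\<And>t x. t \<in> {0..1} \<Longrightarrow> exp_sum B (\<gamma> t) (\<Phi> (t, x)) = \<rho> (t, x) * exp_sum B (\<gamma> 0) x"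
    using iso by (simp_all add: proportional_isotopy_def)
  have equiv: "\<Phi> (t, x + u) = \<Phi> (t, x) + u \<and> \<rho> (t, x + u) = \<rho> (t, x)"
    if "\<And>\<alpha>. \<alpha> \<in> B \<Longrightarrow> \<alpha> \<bullet> u = b" "t \<in> {0..1}" for u b t x
  proof -
    have "\<forall>u b. (\<forall>\<alpha>\<in>B. \<alpha> \<bullet> u = b) \<longrightarrow>
        (\<forall>t\<in>{0..1}. \<forall>x. \<Phi> (t, x + u) = \<Phi> (t, x) + u \<and> \<rho> (t, x + u) = \<rho> (t, x))"
      using iso unfolding proportional_isotopy_def by (elim conjE)
    then show ?thesis using that by metis
  qed
  have equiv_v: "\<Phi> (t, x + s *\<^sub>R v) = \<Phi> (t, x) + s *\<^sub>R v \<and> \<rho> (t, x + s *\<^sub>R v) = \<rho> (t, x)"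
    if "t \<in> {0..1}" for t x s
    using that B by (intro equiv[where b = "s * a"]) (auto simp: inner_commute)
  have f_line: "?f t (x + s *\<^sub>R v) = exp (a * s) * D t x s" for t x s
    by (simp add: D_def mult.assoc[symmetric] exp_add[symmetric])
  have D0: "D t x 0 = ?f t x" for t x by (simp add: D_def)
  have f_R: "?f t x \<in> R" if "t \<in> {0..1}" for t x
    using range[OF that, of x] D0[of t x] by (metis rangeI)
  have solve: "\<exists>s. D t x s = w" if "t \<in> {0..1}" "w \<in> R" for t x w
    using range[OF that(1), of x] that(2) by (metis imageE)

  define \<tau> where "\<tau> = (\<lambda>(t, x). SOME s. D t (\<Phi> (t, x)) s = \<rho> (t, x) * ?f 0 x)"
  have \<tau>: "D t (\<Phi> (t, x)) (\<tau> (t, x)) = \<rho> (t, x) * ?f 0 x" if "t \<in> {0..1}" for t x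
    unfolding \<tau>_def prod.case
    by (rule someI_ex, rule solve[OF that]) (intro scale pos that f_R, simp)
  have \<tau>_unique: "\<tau> (t, x) = s" if "t \<in> {0..1}" "D t (\<Phi> (t, x)) s = \<rho> (t, x) * ?f 0 x" for t x s
    using \<tau>[OF that(1), of x] that strict_mono_eq[OF mono[OF that(1)]] by metis
  have cont\<tau>: "continuous_on ({0..1} \<times> UNIV) \<tau>"
  proof (rule continuous_on_zero_of_strict_mono
      [where G = "\<lambda>z s. D (fst z) (\<Phi> z) s - \<rho> z * ?f 0 (snd z)"])
    show "strict_mono (\<lambda>s. D (fst z) (\<Phi> z) s - \<rho> z * ?f 0 (snd z))"
      if "z \<in> {0..1} \<times> UNIV" for z
      using mono[of "fst z" "\<Phi> z"] that by (auto simp: strict_mono_def)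
    show "D (fst z) (\<Phi> z) (\<tau> z) - \<rho> z * ?f 0 (snd z) = 0" if "z \<in> {0..1} \<times> UNIV" for z
      using \<tau>[of "fst z" "snd z"] that by auto
    have "continuous_on ({0..1} \<times> (UNIV :: (real ^ 'n) set)) (\<lambda>z. \<gamma> (fst z) \<alpha>)" if "\<alpha> \<in> A" for \<alpha>
      by (rule continuous_on_compose2[OF \<gamma>[OF that]]) (auto intro!: continuous_intros)
    then show "continuous_on ({0..1} \<times> UNIV) (\<lambda>z. D (fst z) (\<Phi> z) s - \<rho> z * ?f 0 (snd z))" for s
      unfolding D_def by (intro continuous_intros continuous_on_exp_sum cont\<Phi> cont\<rho>) auto
  qed

  define \<Psi> where "\<Psi> = (\<lambda>z. \<Phi> z + \<tau> z *\<^sub>R v)"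
  define \<kappa> where "\<kappa> = (\<lambda>z. exp (a * \<tau> z) * \<rho> z)"
  have f_\<Psi>: "?f t (\<Psi> (t, x)) = \<kappa> (t, x) * ?f 0 x" if "t \<in> {0..1}" for t x
    using \<tau>[OF that, of x] by (simp add: \<Psi>_def \<kappa>_def f_line)
  have "proportional_isotopy A \<gamma> \<Psi> \<kappa>"
    unfolding proportional_isotopy_def
  proof (intro conjI ballI allI impI)
    show "continuous_on ({0..1} \<times> UNIV) \<Psi>" "continuous_on ({0..1} \<times> UNIV) \<kappa>"
      unfolding \<Psi>_def \<kappa>_def by (intro continuous_intros cont\<Phi> cont\<tau> cont\<rho>)+
  next
    fix t :: real assume t: "t \<in> {0..1}"
    have "inj (\<lambda>x. \<Psi> (t, x))"
    proof (rule injI)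
      fix x y
      assume eq: "\<Psi> (t, x) = \<Psi> (t, y)"
      define s where "s = \<tau> (t, x) - \<tau> (t, y)"
      have "\<Phi> (t, y) = \<Phi> (t, x) + s *\<^sub>R v"
        using eq by (simp add: \<Psi>_def s_def algebra_simps)
      also have "\<dots> = \<Phi> (t, x + s *\<^sub>R v)" using equiv_v[OF t] by simp
      finally have y: "y = x + s *\<^sub>R v"
        using bij_is_inj[OF bij[OF t]] by (simp add: inj_def)
      have "\<kappa> (t, x) * ?f 0 x = \<kappa> (t, y) * ?f 0 y"
        using f_\<Psi>[OF t] eq by metis
      also have "\<kappa> (t, y) = \<kappa> (t, x) * exp (- a * s)"
      proof -
        have "exp (a * \<tau> (t, y)) = exp (a * \<tau> (t, x)) * exp (- a * s)"
          unfolding exp_add[symmetric] s_def by (simp add: algebra_simps)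
        moreover have "\<rho> (t, y) = \<rho> (t, x)" using equiv_v[OF t] y by simp
        ultimately show ?thesis by (simp add: \<kappa>_def)
      qed
      also have "\<kappa> (t, x) * exp (- a * s) * ?f 0 y = \<kappa> (t, x) * D 0 x s"
        unfolding D_def y by simp
      finally have "D 0 x 0 = D 0 x s"
        using pos[OF t, of x] by (simp add: \<kappa>_def D0)
      then have "s = 0" using strict_mono_eq[OF mono[of 0 x]] by simp
      then show "x = y" by (simp add: y)
    qed
    moreover have "surj (\<lambda>x. \<Psi> (t, x))"
      unfolding surj_def
    proof
      fix z
      obtain y where y: "\<Phi> (t, y) = z" using bij_is_surj[OF bij[OF t]] by (metis surjD)
      have "inverse (\<rho> (t, y)) * ?f t z \<in> R"
        using pos[OF t, of y] f_R[OF t] by (intro scale) auto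
      then obtain s where "D 0 y s = inverse (\<rho> (t, y)) * ?f t z"
        using solve[of 0] by force
      then have s: "?f t z = \<rho> (t, y) * D 0 y s" using pos[OF t, of y] by simp
      \<comment> \<open>The displacement at the candidate preimage has to undo the shift by \<open>s\<close>.\<close>
      have "\<tau> (t, y + s *\<^sub>R v) = - s"
      proof (rule \<tau>_unique[OF t])
        have "D t (\<Phi> (t, y + s *\<^sub>R v)) (- s) = exp (a * s) * ?f t z"
          unfolding D_def using equiv_v[OF t, of y s] y by simp
        also have "\<dots> = \<rho> (t, y + s *\<^sub>R v) * ?f 0 (y + s *\<^sub>R v)"
          using equiv_v[OF t, of y s] by (simp add: s f_line)
        finally show "D t (\<Phi> (t, y + s *\<^sub>R v)) (- s) = \<rho> (t, y + s *\<^sub>R v) * ?f 0 (y + s *\<^sub>R v)" .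
      qed
      then have "\<Psi> (t, y + s *\<^sub>R v) = z" using equiv_v[OF t, of y s] y by (simp add: \<Psi>_def)
      then show "\<exists>x. z = \<Psi> (t, x)" by metis
    qed
    ultimately show "bij (\<lambda>x. \<Psi> (t, x))" by (simp add: bij_def)
  next
    fix x
    have "\<tau> (0, x) = 0" by (rule \<tau>_unique) (auto simp: start D0)
    then show "\<Psi> (0, x) = x" "\<kappa> (0, x) = 1" by (simp_all add: \<Psi>_def \<kappa>_def start)
  next
    fix t :: real and x
    assume t: "t \<in> {0..1}"
    show "\<kappa> (t, x) > 0" using pos[OF t, of x] by (simp add: \<kappa>_def)
    have "exp_sum B (\<gamma> t) (\<Psi> (t, x)) = exp (a * \<tau> (t, x)) * exp_sum B (\<gamma> t) (\<Phi> (t, x))"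
      unfolding \<Psi>_def using B by (intro exp_sum_translate) (simp add: inner_commute mult.commute)
    then show "exp_sum A (\<gamma> t) (\<Psi> (t, x)) = \<kappa> (t, x) * exp_sum A (\<gamma> 0) x"
      using f_\<Psi>[OF t, of x] scaled[OF t, of x]
      by (simp add: exp_sum_split[OF fin BA] \<kappa>_def distrib_left)
  next
    fix u b and t :: real and x
    assume u: "\<forall>\<alpha>\<in>A. \<alpha> \<bullet> u = b" and t: "t \<in> {0..1}"
    have eq: "\<Phi> (t, x + u) = \<Phi> (t, x) + u" "\<rho> (t, x + u) = \<rho> (t, x)"
      using equiv[of u b t x] u t BA by blast+
    have f_u: "?f r (y + u) = exp b * ?f r y" for r y
      using u by (intro exp_sum_translate) auto
    have "\<tau> (t, x + u) = \<tau> (t, x)"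
    proof (rule \<tau>_unique[OF t])
      have "D t (\<Phi> (t, x + u)) (\<tau> (t, x)) = exp b * D t (\<Phi> (t, x)) (\<tau> (t, x))"
        unfolding D_def eq using f_u[of t "\<Phi> (t, x) + \<tau> (t, x) *\<^sub>R v"] by (simp add: ac_simps)
      then show "D t (\<Phi> (t, x + u)) (\<tau> (t, x)) = \<rho> (t, x + u) * ?f 0 (x + u)"
        using \<tau>[OF t, of x] by (simp add: eq f_u)
    qed
    then show "\<Psi> (t, x + u) = \<Psi> (t, x) + u" "\<kappa> (t, x + u) = \<kappa> (t, x)"
      by (simp_all add: \<Psi>_def \<kappa>_def eq)
  qed
  then show ?thesis by blast
qed

section \<open>Induction over the faces\<close>

definition faces_separable :: "(real ^ 'n) set \<Rightarrow> (real ^ 'n \<Rightarrow> real) \<Rightarrow> bool" where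
  "faces_separable A \<epsilon> \<longleftrightarrow>
     (\<forall>F. F face_of (convex hull A) \<longrightarrow> F \<noteq> {} \<longrightarrow>
        (\<exists>v a. nontrivial_separating_hyperplane (A \<inter> F) \<epsilon> v a))"

text \<open>
  A face \<open>T\<close> of the polytope is the hull of the support points on it, so the faces of the smaller
  polytope are faces of a face, hence faces of the original polytope.
\<close>

lemma faces_separable_face:
  assumes "finite A" "faces_separable A \<epsilon>" "T face_of (convex hull A)"
  shows "faces_separable (A \<inter> T) \<epsilon>"
proof -
  obtain S where S: "S \<subseteq> A" "T = convex hull S"
    using face_of_convex_hull_subset[OF finite_imp_compact[OF assms(1)] assms(3)] by blast
  have "S \<subseteq> A \<inter> T" using S hull_subset[of S convex] by blast
  then have "T \<subseteq> convex hull (A \<inter> T)" using S hull_mono by metis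
  moreover have "convex hull (A \<inter> T) \<subseteq> T"
    using face_of_imp_convex[OF assms(3)] by (intro hull_minimal) auto
  ultimately have T: "convex hull (A \<inter> T) = T" by blast
  show ?thesis
    unfolding faces_separable_def T
  proof (intro allI impI)
    fix G assume G: "G face_of T" "G \<noteq> {}"
    have "A \<inter> T \<inter> G = A \<inter> G" using face_of_imp_subset[OF G(1)] by blast
    then show "\<exists>v a. nontrivial_separating_hyperplane (A \<inter> T \<inter> G) \<epsilon> v a"
      using assms(2) face_of_trans[OF G(1) assms(3)] G(2) by (simp add: faces_separable_def)
  qed
qed

lemma nontrivial_separating_hyperplane_iff:
  "nontrivial_separating_hyperplane A \<epsilon> v a \<longleftrightarrow>
     v \<noteq> 0 \<and> (\<forall>\<alpha>\<in>A. (\<epsilon> \<alpha> = 1 \<longrightarrow> v \<bullet> \<alpha> \<ge> a) \<and> (\<epsilon> \<alpha> = -1 \<longrightarrow> v \<bullet> \<alpha> \<le> a)) \<and>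
     (\<exists>\<alpha>\<in>A. v \<bullet> \<alpha> \<noteq> a)"
proof (cases "v = 0")
  case False
  have "interior (halfspace_ge v a) = {x. v \<bullet> x > a}" "interior (halfspace_le v a) = {x. v \<bullet> x < a}"
    using False by (simp_all add: halfspace_ge_def halfspace_le_def)
  with False show ?thesis
    by (auto simp: nontrivial_separating_hyperplane_def separating_hyperplane_def
        pos_part_def neg_part_def halfspace_ge_def halfspace_le_def disjoint_iff neq_iff)
qed (simp add: nontrivial_separating_hyperplane_def separating_hyperplane_def)

text \<open>
  If the support lies on one side of the separating hyperplane, the hyperplane is a supporting one,
  and non-triviality makes the set of support points on it strictly smaller; this is the only place
  where the induction hypothesis is needed.
\<close>

lemma ex_proportional_isotopy:
  assumes "signed_support A \<epsilon>" "faces_separable A \<epsilon>" "sign_path A \<epsilon> \<gamma>"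
  shows "\<exists>\<Phi> \<rho>. proportional_isotopy A \<gamma> \<Phi> \<rho>"
  using assms
proof (induction "card A" arbitrary: A rule: less_induct)
  case less
  have fin: "finite A" and signs: "\<And>\<alpha>. \<alpha> \<in> A \<Longrightarrow> \<epsilon> \<alpha> = 1 \<or> \<epsilon> \<alpha> = -1"
    using less.prems(1) by (auto simp: signed_support_def)
  have \<gamma>: "\<And>\<alpha>. \<alpha> \<in> A \<Longrightarrow> continuous_on {0..1} (\<lambda>t. \<gamma> t \<alpha>)"
    and sgn: "\<And>t \<alpha>. t \<in> {0..1} \<Longrightarrow> \<alpha> \<in> A \<Longrightarrow> sgn (\<gamma> t \<alpha>) = \<epsilon> \<alpha>"
    using less.prems(3) by (auto simp: sign_path_def sign_orthant_def)
  show ?case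
  proof (cases "A = {}")
    case True
    then show ?thesis using proportional_isotopy_empty by blast
  next
    case False
    have "convex hull A face_of convex hull A" "A \<inter> convex hull A = A" "convex hull A \<noteq> {}"
      using False hull_subset[of A convex] by (auto simp: face_of_refl)
    then obtain v a where "nontrivial_separating_hyperplane A \<epsilon> v a"
      using less.prems(2) unfolding faces_separable_def by metis
    then have sep: "\<And>\<alpha>. \<alpha> \<in> A \<Longrightarrow> \<epsilon> \<alpha> = 1 \<Longrightarrow> v \<bullet> \<alpha> \<ge> a" "\<And>\<alpha>. \<alpha> \<in> A \<Longrightarrow> \<epsilon> \<alpha> = -1 \<Longrightarrow> v \<bullet> \<alpha> \<le> a"
      and nontrivial: "\<exists>\<alpha>\<in>A. v \<bullet> \<alpha> \<noteq> a"
      by (auto simp: nontrivial_separating_hyperplane_iff)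

    define k where "k = (\<lambda>t x \<alpha>. \<gamma> t \<alpha> * exp (\<alpha> \<bullet> x))"
    define m where "m = (\<lambda>\<alpha>. v \<bullet> \<alpha> - a)"
    have k_pos: "k t x \<alpha> > 0" if "t \<in> {0..1}" "\<alpha> \<in> A" "\<epsilon> \<alpha> = 1" for t x \<alpha>
      using sgn[OF that(1,2)] that(3) by (simp add: k_def sgn_1_pos)
    have k_neg: "k t x \<alpha> < 0" if "t \<in> {0..1}" "\<alpha> \<in> A" "\<epsilon> \<alpha> = -1" for t x \<alpha>
      using sgn[OF that(1,2)] that(3) by (simp add: k_def sgn_1_neg mult_neg_pos)
    have above: "k t x \<alpha> > 0 \<and> m \<alpha> > 0" if "t \<in> {0..1}" "\<alpha> \<in> A" "v \<bullet> \<alpha> > a" for t x \<alpha>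
      using that signs[of \<alpha>] sep(2)[of \<alpha>] k_pos[of t \<alpha> x] by (auto simp: m_def)
    have below: "k t x \<alpha> < 0 \<and> m \<alpha> < 0" if "t \<in> {0..1}" "\<alpha> \<in> A" "v \<bullet> \<alpha> < a" for t x \<alpha>
      using that signs[of \<alpha>] sep(1)[of \<alpha>] k_neg[of t \<alpha> x] by (auto simp: m_def)
    have strict: "k t x \<alpha> * m \<alpha> > 0" if "t \<in> {0..1}" "\<alpha> \<in> A" "v \<bullet> \<alpha> \<noteq> a" for t x \<alpha>
      using above[OF that(1,2)] below[OF that(1,2)] that(3)
      by (metis linorder_less_linear mult_neg_neg mult_pos_pos)
    then have nonneg: "k t x \<alpha> * m \<alpha> \<ge> 0" if "t \<in> {0..1}" "\<alpha> \<in> A" for t x \<alpha>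
      using that by (cases "v \<bullet> \<alpha> = a") (auto simp: m_def less_imp_le)

    \<comment> \<open>Only the set \<open>B\<close> of points not used for the displacement and the range \<open>R\<close> depend on
      which sides of the hyperplane are occupied.\<close>
    have extend: ?thesis
      if B: "B \<subseteq> A" "\<And>\<alpha>. \<alpha> \<in> B \<Longrightarrow> v \<bullet> \<alpha> = a" and iso: "\<exists>\<Phi> \<rho>. proportional_isotopy B \<gamma> \<Phi> \<rho>"
        and range: "\<And>t x. t \<in> {0..1} \<Longrightarrow>
              range (\<lambda>s. \<Sum>\<alpha>\<in>A - B. k t x \<alpha> * exp (m \<alpha> * s)) = R"
        and scale: "\<And>r w. r > 0 \<Longrightarrow> w \<in> R \<Longrightarrow> r * w \<in> R"
      for B R
    proof -
      have line: "(\<lambda>s. exp (- a * s) * exp_sum (A - B) (\<gamma> t) (x + s *\<^sub>R v)) =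
          (\<lambda>s. \<Sum>\<alpha>\<in>A - B. k t x \<alpha> * exp (m \<alpha> * s))" for t x
        unfolding exp_sum_line k_def m_def ..
      obtain \<beta> where \<beta>: "\<beta> \<in> A" "v \<bullet> \<beta> \<noteq> a" using nontrivial by blast
      have mono: "strict_mono (\<lambda>s. \<Sum>\<alpha>\<in>A - B. k t x \<alpha> * exp (m \<alpha> * s))" if "t \<in> {0..1}" for t x
        using \<beta> B(2) fin nonneg[OF that] strict[OF that]
        by (intro exp_sum_line_strict_mono[where j = \<beta>]) auto
      obtain \<Phi> \<rho> where iso': "proportional_isotopy B \<gamma> \<Phi> \<rho>" using iso by blast
      show ?thesis
        by (rule proportional_isotopy_extend[where B = B and v = v and a = a and R = R,
              OF fin B \<gamma> _ _ scale iso'])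
          (unfold line, use mono range in auto)
    qed

    define B where "B = {\<alpha> \<in> A. v \<bullet> \<alpha> = a}"
    have one_sided: "\<exists>\<Phi> \<rho>. proportional_isotopy B \<gamma> \<Phi> \<rho>"
      if face: "(convex hull A \<inter> {x. v \<bullet> x = a}) face_of (convex hull A)"
    proof (rule less.hyps)
      show "card B < card A"
        using fin nontrivial unfolding B_def by (intro psubset_card_mono) auto
      show "signed_support B \<epsilon>"
        using less.prems(1) by (auto simp: signed_support_def B_def)
      show "sign_path B \<epsilon> \<gamma>"
        using less.prems(3) by (auto simp: sign_path_def sign_orthant_def B_def)
      have "A \<inter> (convex hull A \<inter> {x. v \<bullet> x = a}) = B"
        using hull_subset[of A convex] by (auto simp: B_def)
      then show "faces_separable B \<epsilon>"
        using faces_separable_face[OF fin less.prems(2) face] by simp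
    qed
    consider (two_sided) \<alpha> \<beta> where "\<alpha> \<in> A" "v \<bullet> \<alpha> > a" "\<beta> \<in> A" "v \<bullet> \<beta> < a"
      | (upper) "\<And>\<alpha>. \<alpha> \<in> A \<Longrightarrow> v \<bullet> \<alpha> \<ge> a" | (lower) "\<And>\<alpha>. \<alpha> \<in> A \<Longrightarrow> v \<bullet> \<alpha> \<le> a"
      by (meson not_le)
    then show ?thesis
    proof cases
      case (two_sided \<alpha> \<beta>)
      show ?thesis
      proof (rule extend[where B = "{}" and R = UNIV])
        show "range (\<lambda>s. \<Sum>\<alpha>\<in>A - {}. k t x \<alpha> * exp (m \<alpha> * s)) = UNIV" if "t \<in> {0..1}" for t x
          using two_sided fin nonneg[OF that] above[OF that] below[OF that]
          by (intro range_exp_sum_line_two_sided[where i = \<alpha> and j = \<beta>]) auto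
      qed (use proportional_isotopy_empty in auto)
    next
      case upper
      have "convex hull A \<subseteq> {x. v \<bullet> x \<ge> a}"
        using upper by (intro hull_minimal) (auto simp: convex_halfspace_ge)
      then have face: "(convex hull A \<inter> {x. v \<bullet> x = a}) face_of (convex hull A)"
        by (intro face_of_Int_supporting_hyperplane_ge) auto
      show ?thesis
      proof (rule extend[where B = B and R = "{0<..}"])
        show "range (\<lambda>s. \<Sum>\<alpha>\<in>A - B. k t x \<alpha> * exp (m \<alpha> * s)) = {0<..}" if "t \<in> {0..1}" for t x
          using fin nontrivial above[OF that] upper
          by (intro range_exp_sum_line_pos) (auto simp: B_def order.order_iff_strict)
      qed (use one_sided[OF face] in \<open>auto simp: B_def\<close>)
    next
      case lower
      have "convex hull A \<subseteq> {x. v \<bullet> x \<le> a}"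
        using lower by (intro hull_minimal) (auto simp: convex_halfspace_le)
      then have face: "(convex hull A \<inter> {x. v \<bullet> x = a}) face_of (convex hull A)"
        by (intro face_of_Int_supporting_hyperplane_le) auto
      show ?thesis
      proof (rule extend[where B = B and R = "{..<0}"])
        show "range (\<lambda>s. \<Sum>\<alpha>\<in>A - B. k t x \<alpha> * exp (m \<alpha> * s)) = {..<0}" if "t \<in> {0..1}" for t x
          using fin nontrivial below[OF that] lower
          by (intro range_exp_sum_line_neg) (auto simp: B_def order.order_iff_strict)
      qed (use one_sided[OF face] in \<open>auto simp: B_def mult_pos_neg\<close>)
    qed
  qed
qed

section \<open>The isotopy of the zero sets\<close>

lemma sign_path_segment:
  assumes "signed_support A \<epsilon>" "c \<in> sign_orthant A \<epsilon>" "c' \<in> sign_orthant A \<epsilon>"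
  shows "sign_path A \<epsilon> (\<lambda>t \<alpha>. (1 - t) * c \<alpha> + t * c' \<alpha>)"
proof -
  have "sgn ((1 - t) * c \<alpha> + t * c' \<alpha>) = \<epsilon> \<alpha>" if "t \<in> {0..1}" "\<alpha> \<in> A" for t \<alpha>
  proof -
    have "c \<alpha> \<in> S \<Longrightarrow> c' \<alpha> \<in> S \<Longrightarrow> convex S \<Longrightarrow> (1 - t) * c \<alpha> + t * c' \<alpha> \<in> S" for S :: "real set"
      using that(1) convexD[of S "c \<alpha>" "c' \<alpha>" "1 - t" t] by simp
    from this[of "{0<..}"] this[of "{..<0}"] show ?thesis
      using assms that(2)
      by (auto simp: signed_support_def sign_orthant_def sgn_1_pos sgn_1_neg)
        (metis sgn_1_pos sgn_1_neg)+
  qed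
  then show ?thesis
    by (auto simp: sign_path_def sign_orthant_def intro!: continuous_intros)
qed

text \<open>
  Continuity of the inverse maps comes for free from invariance of domain.
\<close>

lemma proportional_isotopy_imp_isotopic:
  assumes "proportional_isotopy A \<gamma> \<Phi> \<rho>"
  shows "isotopic (zero_set (exp_sum A (\<gamma> 0))) (zero_set (exp_sum A (\<gamma> 1)))"
proof -
  have cont: "continuous_on ({0..1} \<times> UNIV) \<Phi>"
    and bij: "\<And>t. t \<in> {0..1} \<Longrightarrow> bij (\<lambda>x. \<Phi> (t, x))"
    and start: "\<And>x. \<Phi> (0, x) = x"
    and pos: "\<And>x. \<rho> (1, x) > 0"
    and scaled: "\<And>x. exp_sum A (\<gamma> 1) (\<Phi> (1, x)) = \<rho> (1, x) * exp_sum A (\<gamma> 0) x"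
    using assms unfolding proportional_isotopy_def by auto
  have "\<exists>G. homeomorphism UNIV UNIV (\<lambda>x. \<Phi> (t, x)) G" if t: "t \<in> {0..1}" for t
  proof -
    have "continuous_on UNIV (\<lambda>x. \<Phi> (t, x))"
      by (rule continuous_on_compose2[OF cont]) (use t in \<open>auto intro!: continuous_intros\<close>)
    then show ?thesis
      using invariance_of_domain_homeomorphism[of UNIV "\<lambda>x. \<Phi> (t, x)"] bij[OF t]
      by (metis bij_is_inj bij_is_surj open_UNIV order_refl)
  qed
  moreover have "(\<lambda>x. \<Phi> (1, x)) ` zero_set (exp_sum A (\<gamma> 0)) = zero_set (exp_sum A (\<gamma> 1))"
  proof -
    have "zero_set (exp_sum A (\<gamma> 0)) = (\<lambda>x. \<Phi> (1, x)) -` zero_set (exp_sum A (\<gamma> 1))"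
      using pos by (auto simp: zero_set_def scaled) (metis less_irrefl)
    then show ?thesis
      using bij_is_surj[OF bij[of 1]] by (simp add: surj_image_vimage_eq)
  qed
  ultimately show ?thesis
    unfolding isotopic_def using cont start by blast
qed

theorem theorem3p5:
  fixes A :: "(real ^ 'n) set" and \<epsilon> :: "real ^ 'n \<Rightarrow> real"
  assumes "signed_support A \<epsilon>"
    and "\<And>F. F face_of (convex hull A) \<Longrightarrow> F \<noteq> {} \<Longrightarrow>
           \<exists>v a. nontrivial_separating_hyperplane (A \<inter> F) \<epsilon> v a"
  shows "\<forall>c \<in> sign_orthant A \<epsilon>. \<forall>c' \<in> sign_orthant A \<epsilon>.
           isotopic (zero_set (exp_sum A c)) (zero_set (exp_sum A c'))"
proof (intro ballI)
  fix c c' assume c: "c \<in> sign_orthant A \<epsilon>" "c' \<in> sign_orthant A \<epsilon>"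
  have "faces_separable A \<epsilon>" using assms(2) by (auto simp: faces_separable_def)
  then obtain \<Phi> \<rho> where "proportional_isotopy A (\<lambda>t \<alpha>. (1 - t) * c \<alpha> + t * c' \<alpha>) \<Phi> \<rho>"
    using ex_proportional_isotopy[OF assms(1) _ sign_path_segment[OF assms(1) c]] by blast
  from proportional_isotopy_imp_isotopic[OF this]
  show "isotopic (zero_set (exp_sum A c)) (zero_set (exp_sum A c'))" by simp
qed

end
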